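(* Let $\mathcal{C}$ be any stabilizer code on $n$ qubits with $n-k$ independent, mutually commuting stabilizer generators $g_1,\dots,g_{n-k}$, where $k=n-(n-k)$ is the number of logical qubits, and let $\hat g_1,\dots,\hat g_{n-k}$ be their holomorphic representations. Let $$\mathcal{C}_{\mathrm{SB}}=\{f\in\mathcal{H}_{\mathrm{SB}}: f \text{ satisfies the homogeneity constraint and } \hat g_m f=f \text{ for } m=1,\dots,n-k\}.$$ Then: (1) $\mathcal{C}_{\mathrm{SB}}$ is a finite-dimensional subspace of $\mathcal{H}_{\mathrm{SB}}$ of dimension $2^k$; (2) $\mathcal{C}_{\mathrm{SB}}$ is invariant under all stabilizer operators, and it is the unique maximal subspace with this property (invariance under all stabilizer operators) within the homogeneous sector.
   Context: Segal--Bargmann space: $\mathcal{H}_{\mathrm{SB}}$ is the space of holomorphic functions $f:\mathbb{C}^{2n}\to\mathbb{C}$ of the variables $\mathbf{z}=(z_{a_1},z_{b_1},\dots,z_{a_n},z_{b_n})$ that are square-integrable with respect to $d\mu(\mathbf{z})=e^{-\|\mathbf{z}\|^2}\prod_{j=1}^n \frac{d^2z_{a_j}\,d^2z_{b_j}}{\pi^2}$. Homogeneity constraint: $\left(z_{a_j}\partial_{z_{a_j}}+z_{b_j}\partial_{z_{b_j}}\right)f=f$ for all $j=1,\dots,n$. The functions satisfying it form the homogeneous sector (physical subspace); they are the functions $f(\mathbf{z})=\sum_{\mathbf{s}\in\{0,1\}^n}c_{\mathbf{s}}\prod_{j=1}^n z_{a_j}^{1-s_j}z_{b_j}^{s_j}$,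 identified with $(\mathbb{C}^2)^{\otimes n}$ via $|0\rangle_j\mapsto z_{a_j}$, $|1\rangle_j\mapsto z_{b_j}$. Holomorphic stabilizer operators: $\hat X_j=z_{a_j}\partial_{z_{b_j}}+z_{b_j}\partial_{z_{a_j}}$, $\hat Y_j=-i(z_{a_j}\partial_{z_{b_j}}-z_{b_j}\partial_{z_{a_j}})$, $\hat Z_j=z_{a_j}\partial_{z_{a_j}}-z_{b_j}\partial_{z_{b_j}}$. For a Pauli string $g=\bigotimes_{j=1}^nP_j$ with $P_j\in\{\mathbb{I},X,Y,Z\}$, $\hat g=\prod_{j:\,P_j\ne\mathbb{I}}\hat P_j$, the product ordered by qubit index. Stabilizer code: given by an abelian subgroup $\mathcal{S}$ of the $n$-qubit Pauli group with $n-k$ independent generators $g_1,\dots,g_{n-k}$ (independent in the standard sense that no product over a nonempty subset of the generators is a scalar multiple of the identity); the code $\mathcal{C}$ is their simultaneous $+1$ eigenspace in $(\mathbb{C}^2)^{\otimes n}$.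
   Formalization: "Invariant under all stabilizer operators" is taken to mean that every vector is fixed (with mere ĝV ⊆ V the whole homogeneous sector would be invariant), and each generator is required to square to the identity, excluding phases ±i, for which the code is zero. *)

theory Defs
  imports "HOL-Analysis.Analysis" "HOL-Library.Function_Algebras" "HOL-Algebra.Generated_Groups"
begin

text \<open>
  Qubits are indexed by a finite linearly ordered type \<open>'n\<close>, so there are \<open>CARD('n)\<close> of them.
  A point of complex \<open>2n\<close>-space is a vector \<open>z :: complex^('n \<times> bool)\<close>:
  \<open>z $ (j, False)\<close> is the variable a of qubit j, and \<open>z $ (j, True)\<close> the variable b.
  Computational basis states are bit vectors, with \<open>False\<close> for 0 and \<open>True\<close> for 1.
\<close>

subsection \<open>The complex vector space of complex-valued functions\<close>

text \<open>Addition and zero of functions are the pointwise ones of \<open>Function_Algebras\<close>.\<close>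

definition fun_scale :: "complex \<Rightarrow> ('a \<Rightarrow> complex) \<Rightarrow> 'a \<Rightarrow> complex" where
  "fun_scale c f = (\<lambda>x. c * f x)"

global_interpretation cfun: vector_space "fun_scale :: complex \<Rightarrow> ('a \<Rightarrow> complex) \<Rightarrow> 'a \<Rightarrow> complex"
  by unfold_locales (auto simp: fun_scale_def fun_eq_iff algebra_simps)

subsection \<open>The Segal--Bargmann space\<close>

definition holomorphic_multi :: "(complex^'m::finite \<Rightarrow> complex) \<Rightarrow> bool" where
  "holomorphic_multi f \<longleftrightarrow>
     (\<forall>z. \<exists>D. (f has_derivative D) (at z) \<and> (\<forall>c v. D (c *s v) = c * D v))"

definition segal_bargmann_measure :: "(complex^('n::finite \<times> bool)) measure" where
  "segal_bargmann_measure =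
     density lborel (\<lambda>z. ennreal (exp (- (norm z)\<^sup>2) / pi ^ (2 * CARD('n))))"

definition segal_bargmann :: "(complex^('n::finite \<times> bool) \<Rightarrow> complex) set" where
  "segal_bargmann =
     {f. holomorphic_multi f \<and> integrable segal_bargmann_measure (\<lambda>z. (cmod (f z))\<^sup>2)}"

definition partial_deriv :: "'m \<Rightarrow> (complex^'m::finite \<Rightarrow> complex) \<Rightarrow> complex^'m \<Rightarrow> complex" where
  "partial_deriv i f z = deriv (\<lambda>w. f (\<chi> l. if l = i then w else z $ l)) (z $ i)"

definition homogeneous_sector :: "(complex^('n::finite \<times> bool) \<Rightarrow> complex) set" where
  "homogeneous_sector =
     {f \<in> segal_bargmann. \<forall>j z.
        z $ (j, False) * partial_deriv (j, False) f z
        + z $ (j, True) * partial_deriv (j, True) f z = f z}"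

subsection \<open>The Pauli group\<close>

datatype pauli = PI | PX | PY | PZ

fun pauli_entry :: "pauli \<Rightarrow> bool \<Rightarrow> bool \<Rightarrow> complex" where
  "pauli_entry PI s t = (if s = t then 1 else 0)"
| "pauli_entry PX s t = (if s \<noteq> t then 1 else 0)"
| "pauli_entry PY s t = (if s = t then 0 else if s then \<i> else - \<i>)"
| "pauli_entry PZ s t = (if s \<noteq> t then 0 else if s then - 1 else 1)"

text \<open>
  An element of the Pauli group is labelled by a phase and a Pauli string; distinct labels have
  distinct matrices.  The matrix is the phase times the Kronecker product of the 2 by 2 matrices.
\<close>

type_synonym 'n pauli_label = "complex \<times> ('n \<Rightarrow> pauli)"

definition pauli_labels :: "'n pauli_label set" where
  "pauli_labels = {1, - 1, \<i>, - \<i>} \<times> UNIV"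

definition pauli_matrix :: "'n::finite pauli_label \<Rightarrow> complex^(bool^'n)^(bool^'n)" where
  "pauli_matrix p = (\<chi> s t. fst p * (\<Prod>j\<in>UNIV. pauli_entry (snd p j) (s $ j) (t $ j)))"

definition pauli_group :: "(complex^(bool^'n::finite)^(bool^'n)) monoid" where
  "pauli_group = \<lparr>carrier = pauli_matrix ` pauli_labels, mult = (**), one = mat 1\<rparr>"

text \<open>
  The stabilizer group (as a set of labels) generated by the Pauli elements \<open>g m\<close>, \<open>m \<in> M\<close>.
\<close>

definition stabilizer_group :: "(nat \<Rightarrow> 'n::finite pauli_label) \<Rightarrow> nat set \<Rightarrow> 'n pauli_label set" where
  "stabilizer_group g M =
     {p \<in> pauli_labels. pauli_matrix p \<in> generate pauli_group ((\<lambda>m. pauli_matrix (g m)) ` M)}"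

definition independent_paulis :: "(nat \<Rightarrow> 'n::finite pauli_label) \<Rightarrow> nat set \<Rightarrow> bool" where
  "independent_paulis g M \<longleftrightarrow>
     (\<forall>T. T \<subseteq> M \<and> T \<noteq> {} \<longrightarrow>
        \<not> (\<exists>c. foldr (\<lambda>m A. pauli_matrix (g m) ** A) (sorted_list_of_set T) (mat 1) = mat c))"

text \<open>
  The Pauli group contains anti-Hermitian elements (phase \<open>\<plusminus>\<i>\<close>), which square to minus the
  identity and have no nonzero fixed vector.  Requiring each generator to square to the identity
  excludes exactly these; for commuting independent generators this is the usual convention that
  a stabilizer group does not contain minus the identity.
\<close>

definition stabilizer_generators :: "(nat \<Rightarrow> 'n::finite pauli_label) \<Rightarrow> nat set \<Rightarrow> bool" where
  "stabilizer_generators g M \<longleftrightarrow>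
     (\<forall>m\<in>M. g m \<in> pauli_labels \<and> pauli_matrix (g m) ** pauli_matrix (g m) = mat 1) \<and>
     (\<forall>l\<in>M. \<forall>m\<in>M. pauli_matrix (g l) ** pauli_matrix (g m)
                     = pauli_matrix (g m) ** pauli_matrix (g l)) \<and>
     independent_paulis g M"

subsection \<open>Holomorphic stabilizer operators and the holomorphic code\<close>

fun pauli_hat :: "pauli \<Rightarrow> 'n::finite \<Rightarrow> (complex^('n \<times> bool) \<Rightarrow> complex)
    \<Rightarrow> complex^('n \<times> bool) \<Rightarrow> complex" where
  "pauli_hat PI j f = f"
| "pauli_hat PX j f = (\<lambda>z. z $ (j, False) * partial_deriv (j, True) f z
                           + z $ (j, True) * partial_deriv (j, False) f z)"
| "pauli_hat PY j f = (\<lambda>z. - \<i> * (z $ (j, False) * partial_deriv (j, True) f z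
                           - z $ (j, True) * partial_deriv (j, False) f z))"
| "pauli_hat PZ j f = (\<lambda>z. z $ (j, False) * partial_deriv (j, False) f z
                           - z $ (j, True) * partial_deriv (j, True) f z)"

definition stabilizer_hat :: "'n::{finite,linorder} pauli_label
    \<Rightarrow> (complex^('n \<times> bool) \<Rightarrow> complex) \<Rightarrow> complex^('n \<times> bool) \<Rightarrow> complex" where
  "stabilizer_hat p f =
     fun_scale (fst p)
       (foldr (\<lambda>j. pauli_hat (snd p j) j) (sorted_list_of_set {j. snd p j \<noteq> PI}) f)"

definition holomorphic_code :: "(nat \<Rightarrow> 'n::{finite,linorder} pauli_label) \<Rightarrow> nat set
    \<Rightarrow> (complex^('n \<times> bool) \<Rightarrow> complex) set" where
  "holomorphic_code g M = {f \<in> homogeneous_sector. \<forall>m\<in>M. stabilizer_hat (g m) f = f}"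

text \<open>
  Invariance under the stabilizer operators means, as usual for stabilizer codes, that every vector
  of the subspace is fixed.  Mere inclusion of the image in \<open>V\<close> would hold for the whole
  homogeneous sector.
\<close>

definition stabilizer_invariant :: "'n::{finite,linorder} pauli_label set
    \<Rightarrow> (complex^('n \<times> bool) \<Rightarrow> complex) set \<Rightarrow> bool" where
  "stabilizer_invariant S V \<longleftrightarrow>
     cfun.subspace V \<and> V \<subseteq> homogeneous_sector \<and> (\<forall>p\<in>S. \<forall>f\<in>V. stabilizer_hat p f = f)"

end

theory Submission
  imports Defs "HOL-Probability.Distributions"
begin

text \<open>
  Euler's equation makes an entire function homogeneous of degree one in each pair of variables;
  being differentiable where that pair vanishes, it equals its differential there, so it is linear
  in the pair.  Hence the homogeneous sector consists of the functions
  \<open>\<Sum>\<^sub>s c\<^sub>s \<Prod>\<^sub>j z\<^sub>j\<^sub>,\<^sub>s\<^sub>j\<close>, all of which are square integrable, and on it a holomorphic stabilizer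
  operator is multiplication of the coefficient vector \<open>c\<close> by the Pauli matrix.

  For the dimension, let \<open>Q\<close> be the product of the matrices \<open>1 + G\<^sub>m\<close> over the \<open>r = n - k\<close>
  generators.  It maps into the joint fixed space \<open>E\<close> and is multiplication by \<open>2\<^sup>r\<close> there, so
  its trace is \<open>2\<^sup>r dim E\<close>.  Expanded, it is the sum of the products of all subsets of
  generators, which by independence are traceless Pauli matrices except for the empty one; so its
  trace is \<open>2\<^sup>n\<close>.
\<close>

subsection \<open>Pauli matrices\<close>

text \<open>This is the tensor product structure: a sum over all bit vectors factors qubit by qubit,
  so matrix products and traces of Pauli strings reduce to 2 by 2 computations.\<close>

lemma prod_sum_vec:
  fixes F :: "'n::finite \<Rightarrow> 'a::finite \<Rightarrow> 'c::comm_semiring_1"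
  shows "(\<Prod>j\<in>UNIV. \<Sum>a\<in>UNIV. F j a) = (\<Sum>s\<in>UNIV. \<Prod>j\<in>UNIV. F j (s $ j))"
proof -
  have "(\<Prod>j\<in>UNIV. \<Sum>a\<in>UNIV. F j a) = (\<Sum>h\<in>UNIV. \<Prod>j\<in>UNIV. F j (h j))"
    using prod_sum_PiE[of UNIV "\<lambda>_. UNIV" F] by (simp add: PiE_UNIV_domain)
  also have "\<dots> = (\<Sum>s\<in>UNIV. \<Prod>j\<in>UNIV. F j (s $ j))"
    by (rule sum.reindex_bij_witness[where i = "\<lambda>s. ($) s" and j = vec_lambda]) auto
  finally show ?thesis .
qed

lemma pauli_matrix_mult_nth:
  "(pauli_matrix p ** pauli_matrix q) $ s $ u
    = fst p * fst q
      * (\<Prod>j\<in>UNIV. \<Sum>t\<in>UNIV. pauli_entry (snd p j) (s $ j) t * pauli_entry (snd q j) t (u $ j))"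
  unfolding prod_sum_vec
  by (simp add: matrix_matrix_mult_def pauli_matrix_def prod.distrib sum_distrib_left mult_ac)

lemma pauli_entry_mult:
  "\<exists>w R. \<forall>s u. (\<Sum>t\<in>UNIV. pauli_entry P s t * pauli_entry Q t u) = w * pauli_entry R s u"
proof -
  have "\<exists>w. \<forall>s u. (\<Sum>t\<in>UNIV. pauli_entry P s t * pauli_entry Q t u)
      = w * pauli_entry (if P = PI then Q else if Q = PI then P else if P = Q then PI
          else if PX \<notin> {P, Q} then PX else if PY \<notin> {P, Q} then PY else PZ) s u" (is "\<exists>w. ?A w")
  proof -
    have "?A 1 \<or> ?A \<i> \<or> ?A (- \<i>)"
      by (cases P; cases Q; simp add: UNIV_bool all_bool_eq)
    then show ?thesis by blast
  qed
  then show ?thesis by blast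
qed

text \<open>The phases of the qubits are collected into one scalar. It is not claimed that
  \<open>r\<close> lies in \<open>pauli_labels\<close>; the trace argument only needs the shape
  scalar times Pauli string.\<close>

lemma pauli_matrix_mult:
  "\<exists>r. pauli_matrix p ** pauli_matrix q = pauli_matrix (r :: 'n::finite pauli_label)"
proof -
  have "\<forall>j. \<exists>w R. \<forall>s u. (\<Sum>t\<in>UNIV. pauli_entry (snd p j) s t * pauli_entry (snd q j) t u)
      = w * pauli_entry R s u"
    using pauli_entry_mult by blast
  then obtain w R where "\<And>j s u. (\<Sum>t\<in>UNIV. pauli_entry (snd p j) s t * pauli_entry (snd q j) t u)
      = w j * pauli_entry (R j) s u"
    by metis
  then have "pauli_matrix p ** pauli_matrix q
      = pauli_matrix (fst p * fst q * (\<Prod>j\<in>UNIV. w j), R)"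
    by (simp add: vec_eq_iff pauli_matrix_mult_nth) (simp add: pauli_matrix_def prod.distrib)
  then show ?thesis by blast
qed

lemma pauli_matrix_identity: "pauli_matrix (w, \<lambda>_. PI) = mat w"
proof -
  have "(\<Prod>j\<in>UNIV. if s $ j = t $ j then 1 else 0 :: complex) = (if s = t then 1 else 0)"
    for s t :: "bool ^ 'n"
    by (auto simp: vec_eq_iff)
  then show ?thesis by (simp add: pauli_matrix_def mat_def vec_eq_iff)
qed

text \<open>A string that is not scalar has a factor X, Y or Z, which is traceless, and the trace is
  the phase times the product of the traces of the factors.\<close>

lemma trace_pauli_matrix:
  assumes "\<nexists>w. pauli_matrix p = mat w"
  shows "trace (pauli_matrix p) = 0"
proof -
  have "p \<noteq> (fst p, \<lambda>_. PI)"
    using assms by (cases p) (auto simp: pauli_matrix_identity)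
  then obtain j where "snd p j \<noteq> PI"
    by (cases p) auto
  then have "(\<Sum>a\<in>UNIV. pauli_entry (snd p j) a a) = 0"
    by (cases "snd p j") (auto simp: UNIV_bool)
  then have "(\<Prod>j\<in>UNIV. \<Sum>a\<in>UNIV. pauli_entry (snd p j) a a) = 0"
    by (intro prod_zero) auto
  then show ?thesis
    by (simp add: trace_def pauli_matrix_def prod_sum_vec flip: sum_distrib_left)
qed

subsection \<open>The dimension of the joint fixed space\<close>

text \<open>For a basis \<open>B\<close> of \<open>E\<close> and the coordinates
  \<open>\<phi> b v\<close> of \<open>A *v v\<close>, the matrix \<open>A\<close> is the sum over
  \<open>b\<close> of the rank one maps sending \<open>v\<close> to \<open>\<phi> b v *s b\<close>.
  Each has trace \<open>\<phi> b b\<close>, which is \<open>c\<close>.\<close>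

lemma trace_eq_dim_of_multiple_of_projection:
  fixes A :: "'a::field ^ 'i ^ 'i"
  assumes sub: "vec.subspace E"
    and range: "\<And>v. A *v v \<in> E"
    and fixed: "\<And>v. v \<in> E \<Longrightarrow> A *v v = c *s v"
  shows "trace A = c * of_nat (vec.dim E)"
proof -
  obtain B where B: "B \<subseteq> E" "vec.independent B" "E \<subseteq> vec.span B" "card B = vec.dim E"
    using vec.basis_exists by blast
  have fin: "finite B" using B(2) by (rule vec.finiteI_independent)
  define \<phi> where "\<phi> b v = vec.representation B (A *v v) b" for b v
  have in_span: "A *v v \<in> vec.span B" for v using range B(3) by blast
  have expand: "(\<Sum>b\<in>B. \<phi> b v *s b) = A *v v" for v
    unfolding \<phi>_def by (rule vec.sum_representation_eq[OF B(2) in_span fin]) simp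
  \<comment> \<open>A linear functional is recovered from its values on the standard basis.\<close>
  have \<phi>_eq: "(\<Sum>i\<in>UNIV. v $ i * \<phi> b (axis i 1)) = \<phi> b v" for b v
  proof -
    have "A *v v = (\<Sum>i\<in>UNIV. v $ i *s (A *v axis i 1))"
      by (simp add: vec_eq_iff matrix_vector_mult_def axis_def mult_ac if_distrib cong: if_cong)
    then show ?thesis
      by (simp add: \<phi>_def vec.representation_sum[OF B(2)] vec.representation_scale[OF B(2)]
          in_span vec.span_scale)
  qed
  have "trace A = (\<Sum>i\<in>UNIV. \<Sum>b\<in>B. \<phi> b (axis i 1) * b $ i)"
  proof -
    have "A $ i $ i = (A *v axis i 1) $ i" for i
      by (simp add: matrix_vector_mult_def axis_def if_distrib cong: if_cong)
    then show ?thesis by (simp add: trace_def flip: expand)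
  qed
  also have "\<dots> = (\<Sum>b\<in>B. \<Sum>i\<in>UNIV. b $ i * \<phi> b (axis i 1))"
    by (subst sum.swap) (simp add: mult_ac)
  also have "\<dots> = (\<Sum>b\<in>B. c)"
  proof (rule sum.cong[OF refl])
    fix b assume b: "b \<in> B"
    have "\<phi> b b = c"
      using fixed[of b] b B(1)
      by (auto simp: \<phi>_def vec.representation_scale[OF B(2)] vec.representation_basis[OF B(2)]
          vec.span_base)
    then show "(\<Sum>i\<in>UNIV. b $ i * \<phi> b (axis i 1)) = c" by (simp add: \<phi>_eq)
  qed
  finally show ?thesis by (simp add: B(4))
qed

section \<open>Products of matrices of the form 1 + G\<close>

lemma matrix_mult_sum_right:
  fixes A :: "'a::semiring_1 ^ 'i ^ 'j"
  shows "A ** (\<Sum>x\<in>X. F x) = (\<Sum>x\<in>X. A ** F x)"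
  by (induction X rule: infinite_finite_induct) (simp_all add: matrix_add_ldistrib)

lemma matrix_add_rdistrib:
  fixes A B :: "'a::semiring_1 ^ 'i ^ 'j"
  shows "(A + B) ** C = A ** C + B ** C"
  by (vector matrix_matrix_mult_def sum.distrib[symmetric] distrib_right)

lemma trace_sum: "trace (\<Sum>x\<in>X. F x) = (\<Sum>x\<in>X. trace (F x))"
  unfolding trace_def by (subst sum.swap) simp

text \<open>The same \<open>foldr\<close> as in \<open>independent_paulis\<close>, so that the
  independence hypothesis applies verbatim; the order is explicit because \<open>**\<close> does not
  commute.\<close>

definition ordered_prod :: "('i \<Rightarrow> 'a::semiring_1^'n^'n) \<Rightarrow> 'i list \<Rightarrow> 'a^'n^'n" where
  "ordered_prod G ms = foldr (\<lambda>m A. G m ** A) ms (mat 1)"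

lemma ordered_prod_simps [simp]:
  "ordered_prod G [] = mat 1"
  "ordered_prod G (m # ms) = G m ** ordered_prod G ms"
  by (simp_all add: ordered_prod_def)

lemma ordered_prod_one_plus:
  fixes G :: "'i::linorder \<Rightarrow> 'a::semiring_1^'n^'n"
  assumes "sorted ms" "distinct ms"
  shows "ordered_prod (\<lambda>m. mat 1 + G m) ms
    = (\<Sum>T\<in>Pow (set ms). ordered_prod G (sorted_list_of_set T))"
  using assms
proof (induction ms)
  case (Cons m ms)
  define H where "H T = ordered_prod G (sorted_list_of_set T)" for T
  have m: "m \<notin> set ms" "\<forall>x\<in>set ms. m < x"
    using Cons.prems by (auto simp: order_less_le)
  have H_insert: "H (insert m T) = G m ** H T" if "T \<in> Pow (set ms)" for T
  proof -
    have "finite T" using that finite_subset by auto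
    moreover have "\<forall>x\<in>T. m < x" "m \<notin> T" using m that by auto
    ultimately have "sorted_list_of_set (insert m T) = m # sorted_list_of_set T"
      by (metis insort_is_Cons less_imp_le set_sorted_list_of_set
          sorted_list_of_set_insert)
    then show ?thesis by (simp add: H_def)
  qed
  have inj: "inj_on (insert m) (Pow (set ms))"
    using m(1) by (auto simp: inj_on_def) 
  have "ordered_prod (\<lambda>m. mat 1 + G m) (m # ms)
      = (mat 1 + G m) ** (\<Sum>T\<in>Pow (set ms). H T)"
    using Cons by (simp add: H_def)
  also have "\<dots> = (\<Sum>T\<in>Pow (set ms). H T) + (\<Sum>T\<in>Pow (set ms). G m ** H T)"
    by (simp add: matrix_mult_sum_right matrix_add_rdistrib sum.distrib)
  also have "(\<Sum>T\<in>Pow (set ms). G m ** H T) = (\<Sum>T\<in>insert m ` Pow (set ms). H T)"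
    by (simp add: sum.reindex[OF inj] H_insert)
  also have "(\<Sum>T\<in>Pow (set ms). H T) + \<dots> = (\<Sum>T\<in>Pow (set (m # ms)). H T)"
    unfolding list.set Pow_insert
    by (subst sum.union_disjoint) (use m(1) in auto)
  finally show ?case by (simp add: H_def)
qed simp

text \<open>\<open>G m\<close> commutes past the other factors until it meets its own, where G (1 +
  G) = G + 1. Hence the product maps into the joint fixed space.\<close>

lemma involution_absorbed_by_ordered_prod:
  fixes G :: "'i \<Rightarrow> 'a::semiring_1^'n^'n"
  assumes comm: "\<And>l m. l \<in> set ms \<Longrightarrow> m \<in> set ms \<Longrightarrow> G l ** G m = G m ** G l"
    and "m \<in> set ms" "G m ** G m = mat 1"
  shows "G m ** ordered_prod (\<lambda>m. mat 1 + G m) ms = ordered_prod (\<lambda>m. mat 1 + G m) ms"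
  using assms
proof (induction ms)
  case (Cons l ms)
  have comm_factor: "G m ** (mat 1 + G l) = (mat 1 + G l) ** G m"
    using Cons.prems(1)[of m l] Cons.prems(2)
    by (simp add: matrix_add_ldistrib matrix_add_rdistrib)
  show ?case
  proof (cases "m = l")
    case True
    then have "G m ** (mat 1 + G l) = mat 1 + G l"
      using Cons.prems(3) by (simp add: matrix_add_ldistrib add.commute)
    then show ?thesis by (simp add: matrix_mul_assoc)
  next
    case False
    then have "G m ** ordered_prod (\<lambda>m. mat 1 + G m) ms = ordered_prod (\<lambda>m. mat 1 + G m) ms"
      using Cons by simp
    then show ?thesis
      by (simp add: matrix_mul_assoc comm_factor) (simp flip: matrix_mul_assoc)
  qed
qed simp

lemma ordered_prod_one_plus_fixed:
  fixes G :: "'i \<Rightarrow> 'a::field^'n^'n"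
  assumes "\<And>m. m \<in> set ms \<Longrightarrow> G m *v v = v"
  shows "ordered_prod (\<lambda>m. mat 1 + G m) ms *v v = 2 ^ length ms *s v"
  using assms
proof (induction ms)
  case (Cons m ms)
  have "ordered_prod (\<lambda>m. mat 1 + G m) (m # ms) *v v = (mat 1 + G m) *v (2 ^ length ms *s v)"
    using Cons by (simp flip: matrix_vector_mul_assoc)
  also have "\<dots> = 2 ^ length ms *s v + 2 ^ length ms *s (G m *v v)"
    by (simp only: matrix_vector_mult_add_rdistrib matrix_vector_mul_lid vector_scalar_commute
        vec.scale_right_distrib)
  also have "\<dots> = 2 ^ length (m # ms) *s v"
    using Cons.prems[of m]
    by (simp only: vec_eq_iff vector_add_component vector_smult_component list.set_intros) simp
  finally show ?case .
qed simp

text \<open>For the Pauli matrices of the generators this is the stabilizer code in the qubit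
  space.\<close>

definition joint_fixed_space :: "('i \<Rightarrow> 'a::semiring_1^'n^'n) \<Rightarrow> 'i set \<Rightarrow> ('a^'n) set" where
  "joint_fixed_space G M = {v. \<forall>m\<in>M. G m *v v = v}"

lemma ordered_prod_pauli:
  fixes g :: "nat \<Rightarrow> 'n::finite pauli_label"
  shows "\<exists>r :: 'n pauli_label. ordered_prod (\<lambda>m. pauli_matrix (g m)) ms = pauli_matrix r"
proof (induction ms)
  case Nil
  show ?case using pauli_matrix_identity[of 1] by (metis ordered_prod_simps(1))
next
  case (Cons m ms)
  then show ?case using pauli_matrix_mult by (metis ordered_prod_simps(2))
qed

lemma subspace_joint_fixed_space:
  "vec.subspace (joint_fixed_space (G :: 'i \<Rightarrow> 'a::field^'n^'n) M)"
  by (auto simp: joint_fixed_space_def vec.subspace_def matrix_vector_right_distrib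
      vector_scalar_commute)

lemma dim_stabilized_space:
  fixes g :: "nat \<Rightarrow> 'n::finite pauli_label"
  assumes "finite M" and gens: "stabilizer_generators g M"
  shows "2 ^ card M * vec.dim (joint_fixed_space (\<lambda>m. pauli_matrix (g m)) M) = 2 ^ CARD('n)"
proof -
  define ms where "ms = sorted_list_of_set M"
  define G where "G m = pauli_matrix (g m)" for m
  define Q where "Q = ordered_prod (\<lambda>m. mat 1 + G m) ms"
  define E where "E = joint_fixed_space G M"
  have ms: "set ms = M" "sorted ms" "distinct ms" "length ms = card M"
    using assms(1) by (simp_all add: ms_def)
  have "trace Q = 2 ^ card M * of_nat (vec.dim E)"
  proof (rule trace_eq_dim_of_multiple_of_projection)
    show "vec.subspace E" unfolding E_def by (rule subspace_joint_fixed_space)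
    show "Q *v v \<in> E" for v
    proof -
      have "G m ** Q = Q" if "m \<in> M" for m
        unfolding Q_def using gens that
        by (intro involution_absorbed_by_ordered_prod)
           (auto simp: ms G_def stabilizer_generators_def)
      then show ?thesis by (simp add: E_def joint_fixed_space_def matrix_vector_mul_assoc)
    qed
    show "Q *v v = 2 ^ card M *s v" if "v \<in> E" for v
      using that ordered_prod_one_plus_fixed[of ms G v]
      by (simp add: Q_def E_def joint_fixed_space_def ms)
  qed
  moreover have "trace Q = 2 ^ CARD('n)"
  proof -
    have "trace (ordered_prod G (sorted_list_of_set T)) = 0" if "T \<subseteq> M" "T \<noteq> {}" for T
    proof -
      have "\<nexists>c. ordered_prod G (sorted_list_of_set T) = mat c"
        using gens that
        unfolding stabilizer_generators_def independent_paulis_def ordered_prod_def G_def by blast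
      then show ?thesis
        using ordered_prod_pauli[of g "sorted_list_of_set T", folded G_def] trace_pauli_matrix by metis
    qed
    \<comment> \<open>Only the empty subset contributes, through the identity matrix of size
      \<open>2 ^ CARD('n)\<close>.\<close>
    then have "trace Q = (\<Sum>T\<in>Pow M. if T = {} then trace (mat 1 :: complex^(bool^'n)^(bool^'n)) else 0)"
      unfolding Q_def ordered_prod_one_plus[OF ms(2,3)] trace_sum ms(1)
      by (intro sum.cong) auto
    also have "\<dots> = 2 ^ CARD('n)"
      using assms(1) by (simp add: sum.delta' trace_I CARD_vec)
    finally show ?thesis .
  qed
  ultimately have "of_nat (2 ^ card M * vec.dim E) = (of_nat (2 ^ CARD('n)) :: complex)"
    by simp
  then show ?thesis
    unfolding of_nat_eq_iff E_def G_def .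
qed

subsection \<open>Multilinear functions of the pairs of variables\<close>

text \<open>The identification of the qubit space with the physical subspace: the basis state
  \<open>s\<close> becomes the monomial that takes variable \<open>s $ j\<close> from the pair of
  qubit \<open>j\<close>.\<close>

definition multilinear :: "complex^(bool^'n) \<Rightarrow> complex^('n::finite \<times> bool) \<Rightarrow> complex" where
  "multilinear c z = (\<Sum>s\<in>UNIV. c $ s * (\<Prod>j\<in>UNIV. z $ (j, s $ j)))"

text \<open>The point where the monomial of \<open>s\<close> is 1 and all others vanish; evaluation
  there reads off a coefficient.\<close>

definition bit_point :: "bool^'n \<Rightarrow> complex^('n::finite \<times> bool)" where
  "bit_point s = (\<chi> l. if snd l = s $ fst l then 1 else 0)"

definition set_pair :: "'n \<Rightarrow> complex \<Rightarrow> complex \<Rightarrow> complex^('n \<times> bool) \<Rightarrow> complex^('n::finite \<times> bool)" where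
  "set_pair j a b z = (\<chi> l. if fst l = j then if snd l then b else a else z $ l)"

lemma set_pair_nth [simp]:
  "set_pair j a b z $ (i, t) = (if i = j then if t then b else a else z $ (i, t))"
  by (simp add: set_pair_def)

lemma multilinear_bit_point [simp]:
  fixes c :: "complex^(bool^'n::finite)"
  shows "multilinear c (bit_point s) = c $ s"
proof -
  have monomial: "(\<Prod>j\<in>UNIV. bit_point s $ (j, t $ j)) = (if t = s then 1 else 0)" for t
  proof (cases "t = s")
    case False
    then obtain j where "t $ j \<noteq> s $ j" by (auto simp: vec_eq_iff)
    then have "(\<Prod>j\<in>UNIV. bit_point s $ (j, t $ j)) = 0"
      by (intro prod_zero) (auto simp: bit_point_def)
    then show ?thesis using False by simp
  qed (simp add: bit_point_def)
  show ?thesis unfolding multilinear_def monomial by (simp add: if_distrib cong: if_cong)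
qed

lemma linear_multilinear: "Vector_Spaces.linear (*s) fun_scale multilinear"
  by unfold_locales
    (auto simp: multilinear_def fun_scale_def fun_eq_iff algebra_simps sum.distrib sum_distrib_left)

lemma inj_multilinear: "inj multilinear"
  by (rule injI) (metis multilinear_bit_point vec_eq_iff)

text \<open>Every monomial is affine in the variable \<open>(j, b)\<close>, with slope 0 if it does
  not contain it.\<close>

lemma partial_deriv_multilinear:
  "partial_deriv (j, b) (multilinear c) z
    = (\<Sum>s\<in>UNIV. if s $ j = b then c $ s * (\<Prod>i\<in>UNIV - {j}. z $ (i, s $ i)) else 0)"
proof -
  have "multilinear c (\<chi> l. if l = (j, b) then w else z $ l)
      = (\<Sum>s\<in>UNIV. c $ s * ((if s $ j = b then w else z $ (j, s $ j))
                            * (\<Prod>i\<in>UNIV - {j}. z $ (i, s $ i))))" for w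
  proof -
    have "(\<Prod>i\<in>UNIV. (\<chi> l. if l = (j, b) then w else z $ l) $ (i, s $ i))
        = (if s $ j = b then w else z $ (j, s $ j)) * (\<Prod>i\<in>UNIV - {j}. z $ (i, s $ i))" for s
      by (subst prod.remove[of _ j]) (auto intro!: prod.cong)
    then show ?thesis by (simp only: multilinear_def)
  qed
  moreover have "((\<lambda>w. if P then w else k) has_field_derivative (if P then 1 else 0)) (at x)"
    for P and k x :: complex by auto
  ultimately show ?thesis
    unfolding partial_deriv_def
    by (intro DERIV_imp_deriv) (auto intro!: derivative_eq_intros sum.cong)
qed

lemma euler_multilinear:
  fixes c :: "complex^(bool^'n::finite)"
  shows "z $ (j, False) * partial_deriv (j, False) (multilinear c) z
    + z $ (j, True) * partial_deriv (j, True) (multilinear c) z = multilinear c z"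
  unfolding partial_deriv_multilinear multilinear_def sum_distrib_left sum.distrib[symmetric]
proof (rule sum.cong[OF refl])
  fix s :: "bool^'n"
  show "z $ (j, False)
        * (if s $ j = False then c $ s * (\<Prod>i\<in>UNIV - {j}. z $ (i, s $ i)) else 0)
      + z $ (j, True)
        * (if s $ j = True then c $ s * (\<Prod>i\<in>UNIV - {j}. z $ (i, s $ i)) else 0)
      = c $ s * (\<Prod>j\<in>UNIV. z $ (j, s $ j))"
    by (subst prod.remove[of UNIV j]) (auto simp: mult_ac)
qed

subsection \<open>Square integrability\<close>

text \<open>The Gaussian factors over the orthonormal basis, and each one-dimensional factor is a
  multiple of the standard normal density.\<close>

lemma integrable_exp_neg_half_norm_square:
  "integrable lborel (\<lambda>x::'a::euclidean_space. exp (- (norm x)\<^sup>2 / 2))"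
proof (rule integrableI_bounded)
  have line: "(\<integral>\<^sup>+(x::real). ennreal (exp (- x\<^sup>2 / 2)) \<partial>lborel) < \<infinity>"
  proof -
    have "integrable lborel (\<lambda>x. sqrt (2 * pi) * std_normal_density x)"
      by simp
    then have "integrable lborel (\<lambda>x::real. exp (- x\<^sup>2 / 2))"
      by (simp add: std_normal_density_def)
    then show ?thesis by (simp add: integrable_iff_bounded)
  qed
  have "(\<integral>\<^sup>+(x::'a). ennreal (norm (exp (- (norm x)\<^sup>2 / 2))) \<partial>lborel)
      = (\<integral>\<^sup>+(x::'a). (\<Prod>b\<in>Basis. ennreal (exp (- (x \<bullet> b)\<^sup>2 / 2))) \<partial>lborel)"
  proof (rule nn_integral_cong)
    fix x :: 'a
    have "(norm x)\<^sup>2 = (\<Sum>b\<in>Basis. (x \<bullet> b)\<^sup>2)"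
      unfolding power2_norm_eq_inner by (subst euclidean_inner) (simp add: power2_eq_square)
    then have "exp (- (norm x)\<^sup>2 / 2) = (\<Prod>b\<in>Basis. exp (- (x \<bullet> b)\<^sup>2 / 2))"
      by (simp add: sum_negf sum_divide_distrib flip: exp_sum)
    then show "ennreal (norm (exp (- (norm x)\<^sup>2 / 2))) = (\<Prod>b\<in>Basis. ennreal (exp (- (x \<bullet> b)\<^sup>2 / 2)))"
      unfolding real_norm_def abs_exp_cancel by (simp only: prod_ennreal exp_ge_zero)
  qed
  also have "\<dots> = (\<Prod>b\<in>(Basis::'a set). \<integral>\<^sup>+x. ennreal (exp (- x\<^sup>2 / 2)) \<partial>lborel)"
    by (subst nn_integral_lborel_prod) auto
  also have "\<dots> < \<infinity>"
    using line by (simp add: power_less_top_ennreal)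
  finally show "(\<integral>\<^sup>+(x::'a). ennreal (norm (exp (- (norm x)\<^sup>2 / 2))) \<partial>lborel) < \<infinity>" .
qed measurable

lemma holomorphic_multi_multilinear:
  fixes c :: "complex^(bool^'n::finite)"
  shows "holomorphic_multi (multilinear c)"
  unfolding holomorphic_multi_def
proof (intro allI exI conjI)
  fix z :: "complex^('n \<times> bool)"
  \<comment> \<open>The product rule applied to each monomial.\<close>
  let ?D = "\<lambda>v. \<Sum>s\<in>UNIV. c $ s * (\<Sum>i\<in>UNIV. v $ (i, s $ i) * (\<Prod>j\<in>UNIV - {i}. z $ (j, s $ j)))"
  show "(multilinear c has_derivative ?D) (at z)"
    unfolding multilinear_def[abs_def]
    by (intro has_derivative_sum has_derivative_mult_right has_derivative_prod
        bounded_linear_imp_has_derivative bounded_linear_vec_nth)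
  show "?D (a *s v) = a * ?D v" for a v
    by (simp add: sum_distrib_left mult_ac)
qed

lemma holomorphic_multi_imp_borel_measurable:
  "holomorphic_multi f \<Longrightarrow> f \<in> borel_measurable borel"
  unfolding holomorphic_multi_def
  by (intro borel_measurable_continuous_onI continuous_at_imp_continuous_on ballI)
     (metis has_derivative_continuous)

lemma multilinear_growth:
  fixes c :: "complex^(bool^'n::finite)"
  shows "cmod (multilinear c z) \<le> (\<Sum>s\<in>UNIV. cmod (c $ s)) * norm z ^ CARD('n)"
proof -
  have "cmod (\<Prod>j\<in>UNIV. z $ (j, s $ j)) \<le> norm z ^ CARD('n)" for s :: "bool^'n"
  proof -
    have "(\<Prod>j\<in>UNIV. cmod (z $ (j, s $ j))) \<le> (\<Prod>j\<in>(UNIV::'n set). norm z)"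
      by (intro prod_mono) (auto simp: Finite_Cartesian_Product.norm_nth_le)
    then show ?thesis by (simp add: prod_norm)
  qed
  then show ?thesis
    unfolding multilinear_def sum_distrib_right
    by (intro sum_norm_le) (simp add: norm_mult mult_left_mono)
qed

text \<open>This is the \<open>N\<close>-th power of t \<le> exp t at t = x / (2 N).\<close>

lemma power_le_exp_half:
  fixes x :: real
  assumes "0 \<le> x" "0 < N"
  shows "x ^ N \<le> (2 * real N) ^ N * exp (x / 2)"
proof -
  have "x / (2 * N) \<le> exp (x / (2 * N))"
    using exp_ge_add_one_self[of "x / (2 * N)"] by linarith
  then have "(x / (2 * N)) ^ N \<le> exp (x / (2 * N)) ^ N"
    using assms by (intro power_mono) auto
  also have "\<dots> = exp (x / 2)"
    using assms(2) by (simp flip: exp_of_nat_mult)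
  finally show ?thesis
    using assms by (simp add: power_divide field_simps)
qed

text \<open>The squared modulus grows at most like the \<open>N\<close>-th power of the squared
  norm. Half of the Gaussian exponent absorbs this, and the other half is integrable.\<close>

lemma multilinear_in_segal_bargmann:
  fixes c :: "complex^(bool^'n::finite)"
  shows "multilinear c \<in> segal_bargmann"
proof -
  define N where "N = CARD('n)"
  define K where "K = (\<Sum>s\<in>UNIV. cmod (c $ s))"
  define h where "h z = exp (- (norm z)\<^sup>2) / pi ^ (2 * N)" for z :: "complex^('n \<times> bool)"
  have [measurable]: "multilinear c \<in> borel_measurable borel"
    by (intro holomorphic_multi_imp_borel_measurable holomorphic_multi_multilinear)
  have [measurable]: "h \<in> borel_measurable borel"
    unfolding h_def by measurable
  have bound: "norm (h z *\<^sub>R (cmod (multilinear c z))\<^sup>2)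
      \<le> K\<^sup>2 * (2 * real N) ^ N / pi ^ (2 * N) * exp (- (norm z)\<^sup>2 / 2)" for z
  proof -
    have "(cmod (multilinear c z))\<^sup>2 \<le> (K * norm z ^ N)\<^sup>2"
      unfolding K_def N_def by (intro power_mono multilinear_growth) simp
    also have "\<dots> = K\<^sup>2 * ((norm z)\<^sup>2) ^ N"
      by (simp add: power_mult_distrib mult.commute flip: power_mult)
    also have "\<dots> \<le> K\<^sup>2 * ((2 * real N) ^ N * exp ((norm z)\<^sup>2 / 2))"
      by (intro mult_left_mono power_le_exp_half) (auto simp: N_def)
    finally have "h z * (cmod (multilinear c z))\<^sup>2
        \<le> h z * (K\<^sup>2 * ((2 * real N) ^ N * exp ((norm z)\<^sup>2 / 2)))"
      by (intro mult_left_mono) (auto simp: h_def)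
    also have "\<dots> = K\<^sup>2 * (2 * real N) ^ N / pi ^ (2 * N)
        * (exp (- (norm z)\<^sup>2) * exp ((norm z)\<^sup>2 / 2))"
      by (simp add: h_def)
    also have "exp (- (norm z)\<^sup>2) * exp ((norm z)\<^sup>2 / 2) = exp (- (norm z)\<^sup>2 / 2)"
      by (simp flip: exp_add)
    finally show ?thesis by (simp add: h_def)
  qed
  have "integrable lborel (\<lambda>z. h z *\<^sub>R (cmod (multilinear c z))\<^sup>2)"
  proof (rule Bochner_Integration.integrable_bound)
    show "integrable lborel (\<lambda>z::complex^('n \<times> bool).
        K\<^sup>2 * (2 * real N) ^ N / pi ^ (2 * N) * exp (- (norm z)\<^sup>2 / 2))"
      by (intro integrable_mult_right integrable_exp_neg_half_norm_square)
  qed (use bound in \<open>auto intro!: AE_I2 order.trans[OF _ abs_ge_self]\<close>)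
  then have "integrable segal_bargmann_measure (\<lambda>z. (cmod (multilinear c z))\<^sup>2)"
    unfolding segal_bargmann_measure_def h_def N_def
    by (subst integrable_density) auto
  then show ?thesis
    by (simp add: segal_bargmann_def holomorphic_multi_multilinear)
qed

subsection \<open>The homogeneous sector\<close>

text \<open>Complex linearity of \<open>D\<close> turns its restriction to the \<open>i\<close>-th
  axis into multiplication by a complex number, which is then the derivative in that
  variable.\<close>

lemma partial_deriv_eq_directional:
  assumes D: "(f has_derivative D) (at y)" and lin: "\<And>c v. D (c *s v) = c * D v"
  shows "partial_deriv i f y = D (axis i 1)"
proof -
  have update: "(\<chi> l. if l = i then w else y $ l) = y + axis i (w - y $ i)" for w
    by (simp add: vec_eq_iff axis_def)
  have axis_linear: "bounded_linear (axis i :: complex \<Rightarrow> complex^'a)"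
    unfolding linear_conv_bounded_linear[symmetric]
    by (rule linearI) (auto simp: vec_eq_iff axis_def)
  have "((\<lambda>w. axis i (w - y $ i)) has_derivative axis i) (at (y $ i))"
    by (rule bounded_linear.has_derivative[OF axis_linear]) (auto intro!: derivative_eq_intros)
  then have "((\<lambda>w. y + axis i (w - y $ i)) has_derivative axis i) (at (y $ i))"
    by (auto intro!: derivative_eq_intros)
  then have "((\<lambda>w. f (y + axis i (w - y $ i))) has_derivative (\<lambda>h. D (axis i h))) (at (y $ i))"
    by (rule has_derivative_compose) (use D in \<open>simp add: axis_def zero_vec_def[symmetric]\<close>)
  moreover have "(\<lambda>h. D (axis i h)) = (*) (D (axis i 1))"
  proof
    fix h :: complex
    have "axis i h = h *s axis i 1" by (simp add: vec_eq_iff axis_def)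
    then show "D (axis i h) = D (axis i 1) * h" by (simp only: lin mult.commute)
  qed
  ultimately have "((\<lambda>w. f (y + axis i (w - y $ i))) has_field_derivative D (axis i 1)) (at (y $ i))"
    by (simp add: has_field_derivative_def)
  then show ?thesis
    by (simp add: partial_deriv_def update DERIV_imp_deriv)
qed

text \<open>The equation makes \<open>\<phi> t\<close> / t constant for positive t, so
  \<open>\<phi>\<close> is linear on [0, 1]; its one-sided derivative at 0 is then both
  \<open>\<phi> 1\<close> and \<open>\<phi>' 0\<close>. Differentiability at 0 is the essential
  input.\<close>

lemma real_homogeneous_of_euler_ode:
  fixes \<phi> :: "real \<Rightarrow> 'a::real_normed_vector"
  assumes deriv: "\<And>t. (\<phi> has_vector_derivative \<phi>' t) (at t)"
    and euler: "\<And>t. t *\<^sub>R \<phi>' t = \<phi> t"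
  shows "\<phi> 1 = \<phi>' 0"
proof -
  have quotient: "((\<lambda>t. inverse t *\<^sub>R \<phi> t) has_vector_derivative 0) (at t within {0<..})"
    if "t \<in> {0<..}" for t
  proof -
    have "((\<lambda>t. inverse t *\<^sub>R \<phi> t) has_vector_derivative
        inverse t *\<^sub>R \<phi>' t + (- (inverse t * inverse t)) *\<^sub>R \<phi> t) (at t)"
      using that by (intro has_vector_derivative_scaleR deriv)
        (auto intro!: derivative_eq_intros simp: power2_eq_square)
    also have "inverse t *\<^sub>R \<phi>' t + (- (inverse t * inverse t)) *\<^sub>R \<phi> t = 0"
      unfolding euler[of t, symmetric] using that by simp
    finally show ?thesis by (rule has_vector_derivative_at_within)
  qed
  obtain k where k: "\<And>t. t \<in> {0<..} \<Longrightarrow> inverse t *\<^sub>R \<phi> t = k"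
    using has_vector_derivative_zero_constant[OF convex_real_interval(3) quotient] by blast
  then have k1: "k = \<phi> 1" using k[of 1] by simp
  have linear: "\<phi> t = t *\<^sub>R \<phi> 1" if "t \<in> {0..1}" for t
  proof (cases "t = 0")
    case True
    \<comment> \<open>At t = 0 the equation reads \<open>\<phi> 0 = 0\<close>.\<close>
    then show ?thesis using euler[of 0] by simp
  next
    case False
    then have "t *\<^sub>R (inverse t *\<^sub>R \<phi> t) = t *\<^sub>R \<phi> 1" using that k[of t] k1 by simp
    then show ?thesis using False by simp
  qed
  have "((\<lambda>t. t *\<^sub>R \<phi> 1) has_vector_derivative \<phi> 1) (at 0 within {0..1})"
    by (auto intro!: derivative_eq_intros)
  then have "(\<phi> has_vector_derivative \<phi> 1) (at 0 within {0..1})"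
    by (rule has_vector_derivative_transform[rotated 2]) (simp, rule linear)
  then show ?thesis
    using vector_derivative_unique_within_closed_interval[of 0 1 0 \<phi> "\<phi> 1" "\<phi>' 0"]
      has_vector_derivative_at_within[OF deriv] by simp
qed

lemma euler_imp_linear_in_pair:
  fixes f :: "complex^('n::finite \<times> bool) \<Rightarrow> complex"
  assumes hol: "holomorphic_multi f"
    and euler: "\<And>z. z $ (j, False) * partial_deriv (j, False) f z
                 + z $ (j, True) * partial_deriv (j, True) f z = f z"
  shows "f z = z $ (j, False) * f (set_pair j 1 0 z) + z $ (j, True) * f (set_pair j 0 1 z)"
proof -
  obtain D where D: "\<And>y. (f has_derivative D y) (at y)" "\<And>y c v. D y (c *s v) = c * D y v"
    using hol unfolding holomorphic_multi_def by metis
  note D_add = linear_add[OF has_derivative_linear[OF D(1)]]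
  note D_scaleR = linear_scale[OF has_derivative_linear[OF D(1)]]
  have at_pair_zero: "f z = z $ (j, False) * partial_deriv (j, False) f (set_pair j 0 0 z)
      + z $ (j, True) * partial_deriv (j, True) f (set_pair j 0 0 z)" for z
  proof -
    \<comment> \<open>The ray \<open>u + t *\<^sub>R v\<close> moves only the pair of qubit
      \<open>j\<close>, from zero at t = 0 to its value in \<open>z\<close> at t = 1; Euler's
      equation restricted to it is the differential equation above.\<close>
    define u where "u = set_pair j 0 0 z"
    define v where "v = z $ (j, False) *s axis (j, False) 1 + z $ (j, True) *s axis (j, True) 1"
    have D_v: "D y v = z $ (j, False) * partial_deriv (j, False) f y
        + z $ (j, True) * partial_deriv (j, True) f y" for y
      by (simp add: v_def D_add D(2) partial_deriv_eq_directional[OF D])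
    have ray: "(u + t *\<^sub>R v) $ (j, b) = of_real t * z $ (j, b)" for t b
      by (cases b) (auto simp: u_def v_def axis_def scaleR_conv_of_real[where 'a = complex])
    have "f (u + 1 *\<^sub>R v) = D (u + 0 *\<^sub>R v) v"
    proof (rule real_homogeneous_of_euler_ode[where \<phi> = "\<lambda>t. f (u + t *\<^sub>R v)"])
      fix t :: real
      show "((\<lambda>t. f (u + t *\<^sub>R v)) has_vector_derivative D (u + t *\<^sub>R v) v) (at t)"
        unfolding has_vector_derivative_def D_scaleR[symmetric]
        by (rule has_derivative_compose[OF _ D(1)]) (auto intro!: derivative_eq_intros)
      show "t *\<^sub>R D (u + t *\<^sub>R v) v = f (u + t *\<^sub>R v)"
        using euler[of "u + t *\<^sub>R v"] unfolding ray D_v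
        by (simp add: scaleR_conv_of_real algebra_simps)
    qed
    moreover have "u + v = z"
      by (auto simp: u_def v_def vec_eq_iff axis_def set_pair_def)
    ultimately show ?thesis by (simp add: D_v u_def)
  qed
  \<comment> \<open>The two coefficients thus do not depend on the pair itself, and setting it to
    (1, 0) and (0, 1) identifies them as values of \<open>f\<close>.\<close>
  have "set_pair j 0 0 (set_pair j a b z) = set_pair j 0 0 z" for a b
    by (simp add: set_pair_def vec_eq_iff)
  then show ?thesis
    using at_pair_zero[of z] at_pair_zero[of "set_pair j 1 0 z"] at_pair_zero[of "set_pair j 0 1 z"]
    by simp
qed

lemma linear_in_pairs_vanishing:
  fixes h :: "complex^('n::finite \<times> bool) \<Rightarrow> complex"
  assumes lin: "\<And>j z. h z = z $ (j, False) * h (set_pair j 1 0 z) + z $ (j, True) * h (set_pair j 0 1 z)"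
    and zero: "\<And>s. h (bit_point s) = 0"
  shows "h z = 0"
proof -
  \<comment> \<open>Induction on a set \<open>J\<close> outside which every pair is already (1, 0)
    or (0, 1); linearity in one more pair removes one qubit from \<open>J\<close>, and for empty
    \<open>J\<close> a bit point remains.\<close>
  have "h z = 0" if "\<And>i. i \<notin> J \<Longrightarrow> \<exists>b. \<forall>a. z $ (i, a) = (if a = b then 1 else 0)" for J z
    using finite[of J] that
  proof (induction J arbitrary: z rule: finite_induct)
    case empty
    then obtain s where "\<And>i a. z $ (i, a) = (if a = s i then 1 else 0)" by (metis empty_iff)
    then have "z = bit_point (\<chi> i. s i)" by (simp add: bit_point_def vec_eq_iff)
    then show ?case by (simp add: zero)
  next
    case (insert j J)
    have "h (set_pair j 1 0 z) = 0"
    proof (rule insert.IH)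
      fix i assume "i \<notin> J"
      then show "\<exists>b. \<forall>a. set_pair j 1 0 z $ (i, a) = (if a = b then 1 else 0)"
        using insert.prems[of i] by (cases "i = j") (auto intro: exI[of _ False])
    qed
    moreover have "h (set_pair j 0 1 z) = 0"
    proof (rule insert.IH)
      fix i assume "i \<notin> J"
      then show "\<exists>b. \<forall>a. set_pair j 0 1 z $ (i, a) = (if a = b then 1 else 0)"
        using insert.prems[of i] by (cases "i = j") (auto intro: exI[of _ True])
    qed
    ultimately show ?case using lin[of z j] by simp
  qed
  from this[of UNIV z] show ?thesis by simp
qed

lemma homogeneous_sector_eq_range_multilinear:
  "homogeneous_sector
    = range (multilinear :: complex^(bool^'n) \<Rightarrow> complex^('n::finite \<times> bool) \<Rightarrow> complex)"
proof (intro equalityI subsetI)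
  fix f :: "complex^('n \<times> bool) \<Rightarrow> complex"
  assume f: "f \<in> homogeneous_sector"
  \<comment> \<open>The only possible coefficients, by evaluation at the bit points; the difference
    is linear in each pair and vanishes at all of these points.\<close>
  define c where "c = (\<chi> s. f (bit_point s))"
  have lin_f: "f z = z $ (j, False) * f (set_pair j 1 0 z) + z $ (j, True) * f (set_pair j 0 1 z)"
    for j z using f by (intro euler_imp_linear_in_pair) (auto simp: homogeneous_sector_def segal_bargmann_def)
  have lin_c: "multilinear c z = z $ (j, False) * multilinear c (set_pair j 1 0 z)
      + z $ (j, True) * multilinear c (set_pair j 0 1 z)" for j z
    by (intro euler_imp_linear_in_pair holomorphic_multi_multilinear euler_multilinear)
  have "f z - multilinear c z = 0" for z
  proof (rule linear_in_pairs_vanishing[where h = "\<lambda>z. f z - multilinear c z"])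
    show "f z - multilinear c z
        = z $ (j, False) * (f (set_pair j 1 0 z) - multilinear c (set_pair j 1 0 z))
        + z $ (j, True) * (f (set_pair j 0 1 z) - multilinear c (set_pair j 0 1 z))" for j z
      by (subst lin_f[of _ j], subst lin_c[of _ j]) (simp add: algebra_simps)
  qed (simp add: c_def)
  then show "f \<in> range multilinear" by (auto simp: fun_eq_iff)
qed (auto simp: homogeneous_sector_def multilinear_in_segal_bargmann euler_multilinear)

subsection \<open>Stabilizer operators on the homogeneous sector\<close>

text \<open>The matrix is read as a substitution in the monomials: variable \<open>s $ i\<close> of
  qubit \<open>i\<close> is replaced by the combination given by column \<open>s $ i\<close> of its
  Pauli factor.\<close>

lemma multilinear_pauli_matrix:
  "multilinear (pauli_matrix p *v c) z
    = fst p * (\<Sum>s\<in>UNIV. c $ s * (\<Prod>i\<in>UNIV. \<Sum>a\<in>UNIV. pauli_entry (snd p i) a (s $ i) * z $ (i, a)))"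
proof -
  have "multilinear (pauli_matrix p *v c) z
      = (\<Sum>u\<in>UNIV. \<Sum>s\<in>UNIV. fst p * (c $ s
          * (\<Prod>i\<in>UNIV. pauli_entry (snd p i) (u $ i) (s $ i) * z $ (i, u $ i))))"
    by (simp add: multilinear_def matrix_vector_mult_def pauli_matrix_def sum_distrib_left
        sum_distrib_right prod.distrib mult_ac)
  also have "\<dots> = (\<Sum>s\<in>UNIV. \<Sum>u\<in>UNIV. fst p * (c $ s
          * (\<Prod>i\<in>UNIV. pauli_entry (snd p i) (u $ i) (s $ i) * z $ (i, u $ i))))"
    by (rule sum.swap)
  finally show ?thesis
    by (simp add: prod_sum_vec sum_distrib_left)
qed

text \<open>Each first-order operator performs this substitution on the variable of qubit
  \<open>j\<close> and leaves the rest of the monomial alone.\<close>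

lemma pauli_hat_multilinear:
  fixes c :: "complex^(bool^'n::finite)"
  shows "pauli_hat P j (multilinear c) = multilinear (pauli_matrix (1, (\<lambda>_. PI)(j := P)) *v c)"
proof
  fix z :: "complex^('n \<times> bool)"
  let ?rest = "\<lambda>s. \<Prod>i\<in>UNIV - {j}. z $ (i, s $ i)"
  have "multilinear (pauli_matrix (1, (\<lambda>_. PI)(j := P)) *v c) z
      = (\<Sum>s\<in>UNIV. c $ s * ((\<Sum>a\<in>UNIV. pauli_entry P a (s $ j) * z $ (j, a)) * ?rest s))"
  proof -
    have "(\<Prod>i\<in>UNIV. \<Sum>a\<in>UNIV. pauli_entry (((\<lambda>_. PI)(j := P)) i) a (s $ i) * z $ (i, a))
        = (\<Sum>a\<in>UNIV. pauli_entry P a (s $ j) * z $ (j, a)) * ?rest s" for s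
      by (subst prod.remove[of UNIV j]) (auto intro!: prod.cong simp: mult_delta_left)
    then show ?thesis by (simp add: multilinear_pauli_matrix)
  qed
  moreover have "pauli_hat P j (multilinear c) z
      = (\<Sum>s\<in>UNIV. c $ s * ((\<Sum>a\<in>UNIV. pauli_entry P a (s $ j) * z $ (j, a)) * ?rest s))"
  proof (cases P)
    case PI
    have "(\<Prod>i\<in>UNIV. z $ (i, s $ i)) = z $ (j, s $ j) * ?rest s" for s
      by (rule prod.remove) auto
    then show ?thesis
      by (simp add: PI multilinear_def mult_delta_left)
  qed (auto simp: partial_deriv_multilinear sum_distrib_left UNIV_bool algebra_simps
      simp flip: sum.distrib sum_subtractf intro!: sum.cong)
  ultimately show "pauli_hat P j (multilinear c) z
      = multilinear (pauli_matrix (1, (\<lambda>_. PI)(j := P)) *v c) z" by simp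
qed

text \<open>On each qubit one of the two factors is the identity, so no phase arises.\<close>

lemma pauli_matrix_mult_disjoint:
  assumes "Q j = PI"
  shows "pauli_matrix (1, (\<lambda>_. PI)(j := P)) ** pauli_matrix (1, Q) = pauli_matrix (1, Q(j := P))"
proof -
  have "(\<Sum>t\<in>UNIV. pauli_entry (((\<lambda>_. PI)(j := P)) i) a t * pauli_entry (Q i) t b)
      = pauli_entry ((Q(j := P)) i) a b" for i a b
    using assms by (cases "i = j") (auto simp: if_distrib if_distribR cong: if_cong)
  then show ?thesis
    by (simp add: vec_eq_iff pauli_matrix_mult_nth) (simp add: pauli_matrix_def)
qed

lemma foldr_pauli_hat_multilinear:
  assumes "distinct js"
  shows "foldr (\<lambda>j. pauli_hat (P j) j) js (multilinear c)
    = multilinear (pauli_matrix (1, \<lambda>j. if j \<in> set js then P j else PI) *v c)"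
  using assms
proof (induction js)
  case Nil
  show ?case by (simp add: pauli_matrix_identity)
next
  case (Cons j js)
  let ?Q = "\<lambda>i. if i \<in> set js then P i else PI"
  have "?Q(j := P j) = (\<lambda>i. if i \<in> set (j # js) then P i else PI)" by auto
  with pauli_matrix_mult_disjoint[of ?Q j "P j"] Cons show ?case
    by (simp add: pauli_hat_multilinear matrix_vector_mul_assoc)
qed

lemma stabilizer_hat_multilinear:
  "stabilizer_hat p (multilinear c) = multilinear (pauli_matrix p *v c)"
proof -
  have "(\<lambda>j. if j \<in> {j. snd p j \<noteq> PI} then snd p j else PI) = snd p" by auto
  then show ?thesis
    by (simp add: stabilizer_hat_def foldr_pauli_hat_multilinear fun_eq_iff fun_scale_def
        multilinear_pauli_matrix)
qed

section \<open>The holomorphic code and its stabilizer group\<close>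

lemma holomorphic_code_eq_image:
  "holomorphic_code g M = multilinear ` joint_fixed_space (\<lambda>m. pauli_matrix (g m)) M"
  by (auto simp: holomorphic_code_def homogeneous_sector_eq_range_multilinear
      joint_fixed_space_def stabilizer_hat_multilinear inj_eq[OF inj_multilinear])

lemma stabilizer_group_fixes:
  assumes gens: "stabilizer_generators g M" and p: "p \<in> stabilizer_group g M"
    and v: "v \<in> joint_fixed_space (\<lambda>m. pauli_matrix (g m)) M"
  shows "pauli_matrix p *v v = v"
proof -
  have generator: "pauli_matrix (g m) *v v = v" if "m \<in> M" for m
    using v that by (simp add: joint_fixed_space_def)
  have "A *v v = v" if "A \<in> generate pauli_group ((\<lambda>m. pauli_matrix (g m)) ` M)" for A
    using that
  proof (induction rule: generate.induct)
    case one
    show ?case by (simp add: pauli_group_def)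
  next
    case (incl A)
    then show ?case using generator by auto
  next
    case (inv A)
    then obtain m where m: "m \<in> M" "A = pauli_matrix (g m)" by auto
    then have A: "A \<in> carrier pauli_group" "A ** A = mat 1"
      using gens by (auto simp: stabilizer_generators_def pauli_group_def)
    \<comment> \<open>A generator is its own inverse. This is checked on the description defining
      \<open>m_inv\<close>, without first showing that \<open>pauli_group\<close> is a
      group.\<close>
    have "m_inv pauli_group A = A"
      unfolding m_inv_def
    proof (rule the_equality)
      fix B assume "B \<in> carrier pauli_group \<and> A \<otimes>\<^bsub>pauli_group\<^esub> B = \<one>\<^bsub>pauli_group\<^esub>
        \<and> B \<otimes>\<^bsub>pauli_group\<^esub> A = \<one>\<^bsub>pauli_group\<^esub>"
      then have "A ** B = mat 1" by (simp add: pauli_group_def)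
      then have "A ** (A ** B) = A" by simp
      then show "B = A" by (simp add: matrix_mul_assoc A(2))
    qed (use A in \<open>auto simp: pauli_group_def\<close>)
    then show ?case using generator m by simp
  next
    case (eng A B)
    then show ?case by (simp add: pauli_group_def flip: matrix_vector_mul_assoc)
  qed
  then show ?thesis using p by (simp add: stabilizer_group_def)
qed

lemma generator_in_stabilizer_group:
  assumes "stabilizer_generators g M" "m \<in> M"
  shows "g m \<in> stabilizer_group g M"
  using assms by (auto simp: stabilizer_group_def stabilizer_generators_def intro: generate.incl)

text \<open>An injective linear map preserves dimension. The finite spanning set is stated
  separately because \<open>cfun.dim\<close> is a total function with value 0 on
  infinite-dimensional spaces.\<close>

lemma dim_multilinear_image:
  fixes E :: "(complex^(bool^'n::finite)) set"
  assumes "vec.subspace E"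
  shows "cfun.subspace (multilinear ` E)"
    and "\<exists>B. finite B \<and> cfun.span B = multilinear ` E"
    and "cfun.dim (multilinear ` E) = vec.dim E"
proof -
  \<comment> \<open>Only the domain is finite-dimensional here; the codomain consists of all
    functions.\<close>
  interpret pair: finite_dimensional_vector_space_pair_1
    "(*s) :: complex \<Rightarrow> complex^(bool^'n) \<Rightarrow> complex^(bool^'n)" cart_basis
    "fun_scale :: complex \<Rightarrow> (complex^('n \<times> bool) \<Rightarrow> complex) \<Rightarrow> complex^('n \<times> bool) \<Rightarrow> complex" ..
  show "cfun.subspace (multilinear ` E)"
    by (rule pair.linear_subspace_image[OF linear_multilinear assms])
  show "cfun.dim (multilinear ` E) = vec.dim E"
    by (rule pair.dim_image_eq[OF linear_multilinear inj_on_subset[OF inj_multilinear]]) simp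
  obtain B where B: "B \<subseteq> E" "vec.independent B" "E \<subseteq> vec.span B"
    using vec.basis_exists[of E] by metis
  then have "vec.span B = E"
    using assms vec.span_minimal by blast
  then have "cfun.span (multilinear ` B) = multilinear ` E"
    using pair.linear_span_image[OF linear_multilinear] by metis
  moreover have "finite B" using B(2) by (rule vec.finiteI_independent)
  ultimately show "\<exists>B. finite B \<and> cfun.span B = multilinear ` E" by blast
qed

theorem mainTheorem2:
  fixes g :: "nat \<Rightarrow> 'n::{finite,linorder} pauli_label"
    and k :: nat
  assumes "k \<le> CARD('n)"
    and "stabilizer_generators g {1..CARD('n) - k}"
  defines "S \<equiv> stabilizer_group g {1..CARD('n) - k}"
    and "C \<equiv> holomorphic_code g {1..CARD('n) - k}"
  shows "(C \<subseteq> segal_bargmann \<and> cfun.subspace C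
          \<and> (\<exists>B. finite B \<and> cfun.span B = C) \<and> cfun.dim C = 2 ^ k)
       \<and> (stabilizer_invariant S C
          \<and> (\<forall>V. stabilizer_invariant S V \<longrightarrow> V \<subseteq> C)
          \<and> (\<forall>V. (stabilizer_invariant S V
                  \<and> (\<forall>W. stabilizer_invariant S W \<and> V \<subseteq> W \<longrightarrow> W = V)) \<longleftrightarrow> V = C))"
proof -
  define M where "M = {1..CARD('n) - k}"
  define E where "E = joint_fixed_space (\<lambda>m. pauli_matrix (g m)) M"
  have gens: "stabilizer_generators g M" using assms(2) by (simp add: M_def)
  have S: "S = stabilizer_group g M" by (simp add: S_def M_def)
  have C: "C = multilinear ` E" by (simp add: C_def M_def E_def holomorphic_code_eq_image)
  have E: "vec.subspace E" unfolding E_def by (rule subspace_joint_fixed_space)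
  have "2 ^ (CARD('n) - k) * vec.dim E = 2 ^ CARD('n)"
    using dim_stabilized_space[OF _ gens] unfolding E_def by (simp add: M_def)
  \<comment> \<open>Here k \<le> n makes the truncated subtraction exact.\<close>
  also have "\<dots> = 2 ^ (CARD('n) - k) * 2 ^ k"
    using assms(1) by (simp flip: power_add)
  finally have dim: "vec.dim E = 2 ^ k" by simp
  have sector: "C \<subseteq> homogeneous_sector"
    by (auto simp: C homogeneous_sector_eq_range_multilinear)
  then have segal: "C \<subseteq> segal_bargmann" by (auto simp: homogeneous_sector_def)
  have invariant: "stabilizer_invariant S C"
    using sector dim_multilinear_image(1)[OF E] stabilizer_group_fixes[OF gens]
    by (auto simp: stabilizer_invariant_def C S E_def stabilizer_hat_multilinear)
  have maximal: "V \<subseteq> C" if "stabilizer_invariant S V" for V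
    using that generator_in_stabilizer_group[OF gens]
    by (auto simp: stabilizer_invariant_def S C_def holomorphic_code_def M_def)
  \<comment> \<open>\<open>C\<close> is invariant and contains every invariant subspace, so a
    maximal one must equal it.\<close>
  have unique: "stabilizer_invariant S V \<and> (\<forall>W. stabilizer_invariant S W \<and> V \<subseteq> W \<longrightarrow> W = V)
      \<longleftrightarrow> V = C" for V
    using invariant maximal by (metis subset_antisym)
  show ?thesis
    using segal dim_multilinear_image[OF E, folded C, unfolded dim] invariant maximal unique
    by (intro conjI allI impI)
qed

end
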